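(* Let $L_1,L_2\in(0,\infty]$ and $\mu_1,\mu_2\in[0,\infty)$ with $L_1>\mu_2$ and $L_2>\mu_1$, and suppose that $L_1$ or $L_2$ is finite. Let $f_1\in\mathcal{F}_{\mu_1,L_1}(\mathbb{R}^n)$, $f_2\in\mathcal{F}_{\mu_2,L_2}(\mathbb{R}^n)$, let $f=f_1-f_2$ be lower semicontinuous and bounded below, let $f^\star\in\mathbb{R}$ be a lower bound of $f$ on $\mathbb{R}^n$, and let $f(x^1)-f^\star=\Delta$. Let $N\ge 1$, and let $x^1,\dots,x^{N+1}$ together with $g_1^k\in\partial f_1(x^k)$ and $g_2^k\in\partial f_2(x^k)$ ($1\le k\le N+1$) be generated by $N$ iterations of the DCA started at $x^1$. Then $$\min_{1\leq k\leq N+1}\left\|g_1^k-g_2^k\right\|\leq\sqrt{\frac{\mathcal{A}\,\Delta}{\mathcal{B} N+\mathcal{C}}},$$ where $$\mathcal{A}=2\left(L_1L_2-\mu_1L_2\,I_{\mathbb{R}_+}(L_1-L_2)-\mu_2L_1\,I_{\mathbb{R}_+}(L_2-L_1)\right),$$ $$\mathcal{B}=L_1+L_2+\mu_1\left(\tfrac{L_1}{L_2}-3\right)I_{\mathbb{R}_+}(L_1-L_2)+\mu_2\left(\tfrac{L_2}{L_1}-3\right)I_{\mathbb{R}_+}(L_2-L_1),$$ $$\mathcal{C}=\frac{L_1L_2-\mu_1L_2\,I_{\mathbb{R}_+}(L_1-L_2)-\mu_2L_1\,I_{\mathbb{R}_+}(L_2-L_1)}{L_1-\mu_2}.$$ If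 $L_1=\infty$ or $L_2=\infty$, the quotient $\mathcal{A}/(\mathcal{B}N+\mathcal{C})$ is understood as its limit as that constant tends to $\infty$.
   Context: $\|\cdot\|$ and $\langle\cdot,\cdot\rangle$ are the Euclidean norm and inner product on $\mathbb{R}^n$. For an extended-valued convex function $h$, $\partial h(x)=\{g: h(y)\ge h(x)+\langle g,y-x\rangle\ \forall y\in\mathbb{R}^n\}$ for $x$ with $h(x)<\infty$. For $L\in(0,\infty]$, $h$ is $L$-smooth if $\|g_1-g_2\|\le L\|x_1-x_2\|$ for all $x_1,x_2\in\mathbb{R}^n$, $g_1\in\partial h(x_1)$, $g_2\in\partial h(x_2)$ (if $L<\infty$ then $h$ is differentiable on $\mathbb{R}^n$; every convex function is $\infty$-smooth). For $\mu\ge0$, $h$ is $\mu$-strongly convex if $x\mapsto h(x)-\frac{\mu}{2}\|x\|^2$ is convex. $\mathcal{F}_{\mu,L}(\mathbb{R}^n)$ is the set of closed proper convex functions $h:\mathbb{R}^n\to(-\infty,\infty]$ that are $L$-smooth and $\mu$-strongly convex. The difference $f_1-f_2$ is taken to be $+\infty$ wherever $f_1=+\infty$. $I_{\mathbb{R}_+}(x)=1$ if $x\ge0$ (including $x=\infty$) and $I_{\mathbb{R}_+}(x)=0$ if $x<0$ (including $x=-\infty$). DCA (Difference-of-Convex Algorithm): starting from $x^1\in\mathbb{R}^n$, for $k=1,2,\dots$ choose $g_2^k\in\partial f_2(x^k)$ and then choose $x^{k+1}\in\operatorname{argmin}_{x\in\mathbb{R}^n}\, f_1(x)-f_2(x^k)-\langle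 g_2^k,x-x^k\rangle$. It is assumed that the iterates exist and that $\partial f_1(x^k)\neq\emptyset$ and $\partial f_2(x^k)\ne\emptyset$ for all $k$. The subgradients of $f_1$ associated with the run are: $g_1^1\in\partial f_1(x^1)$ arbitrary, and $g_1^{k+1}:=g_2^k\in\partial f_1(x^{k+1})$ for $1\le k\le N$ (which holds by optimality of $x^{k+1}$); $g_2^{N+1}\in\partial f_2(x^{N+1})$ is arbitrary.
   Formalization: When L_1 = L_2 = μ_1 + μ_2, both A and BN + C vanish and the quotient is 0/0; there it is read as its limit in L_1, namely 2L_1/(2N + L_1/(L_1 − μ_2)), and the bound is proved with that value. *)

theory Defs
  imports "HOL-Analysis.Analysis"
begin

section \<open>Extended-valued convex functions\<close>

definition ereal_epigraph :: "('a \<Rightarrow> ereal) \<Rightarrow> ('a \<times> real) set" where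
  "ereal_epigraph h = {(x, r). h x \<le> ereal r}"

definition ereal_convex :: "('a::real_vector \<Rightarrow> ereal) \<Rightarrow> bool" where
  "ereal_convex h \<longleftrightarrow> convex (ereal_epigraph h)"

definition ereal_closed :: "('a::topological_space \<Rightarrow> ereal) \<Rightarrow> bool" where
  "ereal_closed h \<longleftrightarrow> closed (ereal_epigraph h)"

definition ereal_proper :: "('a \<Rightarrow> ereal) \<Rightarrow> bool" where
  "ereal_proper h \<longleftrightarrow> (\<forall>x. h x \<noteq> -\<infinity>) \<and> (\<exists>x. h x < \<infinity>)"

definition lower_semicont :: "('a::topological_space \<Rightarrow> ereal) \<Rightarrow> bool" where
  "lower_semicont h \<longleftrightarrow> (\<forall>x. h x \<le> Liminf (at x) h)"

text \<open>The subdifferential is empty outside the effective domain.\<close>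

definition subdifferential :: "('a::real_inner \<Rightarrow> ereal) \<Rightarrow> 'a \<Rightarrow> 'a set" where
  "subdifferential h x =
     {g. h x < \<infinity> \<and> (\<forall>y. h y \<ge> h x + ereal (g \<bullet> (y - x)))}"

text \<open>The case \<open>L = \<infinity>\<close> is separated because \<open>\<infinity> * 0 = 0\<close> in \<^typ>\<open>ereal\<close>: the inequality
  with \<open>L = \<infinity>\<close> and \<open>x\<^sub>1 = x\<^sub>2\<close> would exclude nondifferentiable functions.\<close>

definition L_smooth :: "ereal \<Rightarrow> ('a::real_inner \<Rightarrow> ereal) \<Rightarrow> bool" where
  "L_smooth L h \<longleftrightarrow> L = \<infinity> \<or>
     (\<forall>x1 x2. \<forall>g1\<in>subdifferential h x1. \<forall>g2\<in>subdifferential h x2.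
        ereal (norm (g1 - g2)) \<le> L * ereal (norm (x1 - x2)))"

definition strongly_convex :: "real \<Rightarrow> ('a::real_inner \<Rightarrow> ereal) \<Rightarrow> bool" where
  "strongly_convex \<mu> h \<longleftrightarrow> ereal_convex (\<lambda>x. h x - ereal (\<mu> / 2 * (norm x)\<^sup>2))"

definition F_class :: "real \<Rightarrow> ereal \<Rightarrow> ('a::euclidean_space \<Rightarrow> ereal) set" where
  "F_class \<mu> L = {h. ereal_closed h \<and> ereal_proper h \<and> ereal_convex h \<and>
     L_smooth L h \<and> strongly_convex \<mu> h}"

section \<open>Difference-of-convex programs and the DCA\<close>

definition dc_diff :: "('a \<Rightarrow> ereal) \<Rightarrow> ('a \<Rightarrow> ereal) \<Rightarrow> 'a \<Rightarrow> ereal" where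
  "dc_diff f1 f2 x = (if f1 x = \<infinity> then \<infinity> else f1 x - f2 x)"

text \<open>\<open>N\<close> iterations with iterates \<open>x 1, \<dots>, x (N + 1)\<close>; values of the sequences at other indices
  are irrelevant. Each \<open>g1 k\<close> with \<open>k \<ge> 2\<close> is a subgradient of \<open>f1\<close> at \<open>x k\<close> by optimality of
  \<open>x k\<close>, so this is not demanded separately.\<close>

definition dca_run ::
  "('a::real_inner \<Rightarrow> ereal) \<Rightarrow> ('a \<Rightarrow> ereal) \<Rightarrow> nat \<Rightarrow>
     (nat \<Rightarrow> 'a) \<Rightarrow> (nat \<Rightarrow> 'a) \<Rightarrow> (nat \<Rightarrow> 'a) \<Rightarrow> bool" where
  "dca_run f1 f2 N x g1 g2 \<longleftrightarrow>
     g1 1 \<in> subdifferential f1 (x 1) \<and>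
     (\<forall>k\<in>{1..N+1}. g2 k \<in> subdifferential f2 (x k)) \<and>
     (\<forall>k\<in>{1..N}.
        is_arg_min (\<lambda>y. f1 y - f2 (x k) - ereal (g2 k \<bullet> (y - x k))) (\<lambda>y. True) (x (k + 1)) \<and>
        g1 (k + 1) = g2 k)"

section \<open>Constants of the convergence rate\<close>

abbreviation I_nonneg :: "real \<Rightarrow> real" where
  "I_nonneg \<equiv> indicator {0..}"

definition rate_A :: "real \<Rightarrow> real \<Rightarrow> real \<Rightarrow> real \<Rightarrow> real" where
  "rate_A L1 L2 \<mu>1 \<mu>2 =
     2 * (L1 * L2 - \<mu>1 * L2 * I_nonneg (L1 - L2) - \<mu>2 * L1 * I_nonneg (L2 - L1))"

definition rate_B :: "real \<Rightarrow> real \<Rightarrow> real \<Rightarrow> real \<Rightarrow> real" where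
  "rate_B L1 L2 \<mu>1 \<mu>2 =
     L1 + L2 + \<mu>1 * (L1 / L2 - 3) * I_nonneg (L1 - L2) + \<mu>2 * (L2 / L1 - 3) * I_nonneg (L2 - L1)"

definition rate_C :: "real \<Rightarrow> real \<Rightarrow> real \<Rightarrow> real \<Rightarrow> real" where
  "rate_C L1 L2 \<mu>1 \<mu>2 =
     (L1 * L2 - \<mu>1 * L2 * I_nonneg (L1 - L2) - \<mu>2 * L1 * I_nonneg (L2 - L1)) / (L1 - \<mu>2)"

definition rate_denom :: "real \<Rightarrow> real \<Rightarrow> real \<Rightarrow> real \<Rightarrow> nat \<Rightarrow> real" where
  "rate_denom L1 L2 \<mu>1 \<mu>2 N = rate_B L1 L2 \<mu>1 \<mu>2 * real N + rate_C L1 L2 \<mu>1 \<mu>2"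

definition finite_rate :: "real \<Rightarrow> real \<Rightarrow> real \<Rightarrow> real \<Rightarrow> nat \<Rightarrow> real" where
  "finite_rate L1 L2 \<mu>1 \<mu>2 N = rate_A L1 L2 \<mu>1 \<mu>2 / rate_denom L1 L2 \<mu>1 \<mu>2 N"

text \<open>An infinite smoothness constant is handled by the limit of the quotient; the conventions
  \<open>I(\<infinity>) = 1\<close> and \<open>I(-\<infinity>) = 0\<close> are then the eventual values of the indicators.
  For finite constants with \<open>L1 > \<mu>2\<close>, \<open>L2 > \<mu>1\<close> (and nonempty function classes), the denominator
  vanishes only if \<open>L1 = L2 = \<mu>1 + \<mu>2\<close>, where the quotient is the indeterminate form \<open>0/0\<close>
  (which would be \<open>0\<close> in HOL). There too it is read as a limit, in \<open>L1\<close>; the singularity is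
  removable and the value is that of \<open>2 * L1 / (2 * N + L1 / (L1 - \<mu>2))\<close>, the reduced form
  of the quotient whenever \<open>L1 = L2\<close>.\<close>

definition rate_quotient :: "ereal \<Rightarrow> ereal \<Rightarrow> real \<Rightarrow> real \<Rightarrow> nat \<Rightarrow> real" where
  "rate_quotient L1 L2 \<mu>1 \<mu>2 N =
     (if L1 = \<infinity> then Lim at_top (\<lambda>l. finite_rate l (real_of_ereal L2) \<mu>1 \<mu>2 N)
      else if L2 = \<infinity> then Lim at_top (\<lambda>l. finite_rate (real_of_ereal L1) l \<mu>1 \<mu>2 N)
      else if rate_denom (real_of_ereal L1) (real_of_ereal L2) \<mu>1 \<mu>2 N = 0
        then Lim (at (real_of_ereal L1)) (\<lambda>l. finite_rate l (real_of_ereal L2) \<mu>1 \<mu>2 N)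
      else finite_rate (real_of_ereal L1) (real_of_ereal L2) \<mu>1 \<mu>2 N)"

end

theory Submission
  imports Defs
begin

text \<open>
  One iteration of the DCA compares the consecutive iterates \<open>x\<close> and \<open>x'\<close> through the subgradient
  \<open>g\<close> that \<open>f2\<close> has at \<open>x\<close> and \<open>f1\<close> has at \<open>x'\<close>. Adding the two subgradient inequalities based on
  \<open>g\<close> cancels the linear terms, so the decrease of \<open>f1 - f2\<close> is the sum of the gaps in these
  inequalities. For a function that is \<open>\<mu>\<close>-strongly convex and \<open>L\<close>-smooth, such a gap is bounded below
  by a quadratic form in the difference of the subgradients and the difference \<open>d = x - x'\<close> of the
  points (\<open>subgradient_gap_bound\<close>). In the gap of \<open>f1\<close> the subgradient difference is \<open>g1 k - g2 k\<close>,
  and in the gap of \<open>f2\<close> it is, up to sign, \<open>g1 (k + 1) - g2 (k + 1)\<close>: these are the quantities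
  whose norms have to be bounded.

  For a given subgradient difference this form is smallest when \<open>norm d\<close> is \<open>1 / L\<close> times its norm,
  and smoothness of either function forces \<open>norm d\<close> to be at least \<open>1 / L\<close> times the norm of the
  subgradient difference of that function. When all these norms are equal, the smaller of the two
  constants gives the stronger constraint, which keeps the form of the function with the larger
  constant away from its minimum. Therefore strong convexity is exploited only for the function with
  the larger constant, and the other function contributes its Lipschitz bound
  (\<open>gap_sum_ge_gain\<close>). If \<open>m\<close> is the smallest of the norms \<open>norm (g1 k - g2 k)\<close>, every
  iteration decreases the objective by at least a constant multiple of \<open>m\<^sup>2\<close>
  (\<open>dca_step_decrease\<close>). At the last iterate the objective still lies above its lower bound by a
  multiple of \<open>m\<^sup>2\<close>, because for finite \<open>L1\<close> the difference \<open>f1 - f2\<close> has a quadratic upper bound of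
  curvature \<open>L1 - \<mu>2\<close> based there (\<open>criticality_gap_bound\<close>). Summing up bounds a multiple of \<open>m\<^sup>2\<close> by \<open>\<Delta>\<close>.

  All estimates are expressed in the reciprocals \<open>1 / L1\<close> and \<open>1 / L2\<close>, with value \<open>0\<close> at \<open>\<infinity>\<close>. In
  these variables the bound is continuous at the infinite constants and across \<open>L1 = L2\<close>, which
  identifies it with the quotient in the theorem in all cases, including those where that quotient
  is read as a limit (\<open>rate_quotient_eq\<close>).

  The analytic input is that a closed proper convex function with a finite smoothness constant is
  subdifferentiable everywhere and obeys the quadratic upper bound. Subdifferentiability comes from
  proximal points and a fixed-point argument (\<open>proximal_point_exists\<close>,
  \<open>subdifferential_nonempty_if_smooth\<close>).
\<close>

section \<open>Subgradients of convex functions\<close>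

lemma subdifferential_realE:
  assumes "ereal_proper h" and "g \<in> subdifferential h x"
  obtains a where "h x = ereal a" and "\<And>y. ereal (a + g \<bullet> (y - x)) \<le> h y"
proof -
  have "h x \<noteq> -\<infinity>" "h x < \<infinity>"
    using assms by (auto simp: ereal_proper_def subdifferential_def)
  then obtain a where a: "h x = ereal a" by (cases "h x") auto
  with assms(2) that show thesis by (auto simp: subdifferential_def)
qed

lemma subdifferentialI:
  assumes "h x = ereal a" and "\<And>y. ereal (a + g \<bullet> (y - x)) \<le> h y"
  shows "g \<in> subdifferential h x"
  using assms by (auto simp: subdifferential_def)

lemma subdifferential_monotone:
  assumes "ereal_proper h" and "g \<in> subdifferential h x" and "g' \<in> subdifferential h x'"
  shows "0 \<le> (g - g') \<bullet> (x - x')"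
proof -
  obtain a where a: "h x = ereal a" "\<And>y. ereal (a + g \<bullet> (y - x)) \<le> h y"
    using subdifferential_realE assms(1,2) by blast
  obtain a' where a': "h x' = ereal a'" "\<And>y. ereal (a' + g' \<bullet> (y - x')) \<le> h y"
    using subdifferential_realE assms(1,3) by blast
  show ?thesis
    using a(2)[of x'] a'(2)[of x] a(1) a'(1) by (simp add: inner_diff_left inner_diff_right)
qed

text \<open>On the segment from \<open>x\<close> to \<open>y\<close> convexity bounds \<open>h\<close> above by the chord. At distance
  proportional to \<open>t\<close> from \<open>x\<close> the quadratic term is of order \<open>t\<^sup>2\<close>, so it disappears after division
  by \<open>t\<close> as \<open>t \<rightarrow> 0\<close>.\<close>

lemma convex_quadratic_minorant_imp_affine:
  fixes h :: "'a::real_inner \<Rightarrow> ereal"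
  assumes "ereal_convex h" and hx: "h x = ereal a"
    and minor: "\<And>z. ereal (a + g \<bullet> (z - x) - c * (norm (z - x))\<^sup>2) \<le> h z"
  shows "ereal (a + g \<bullet> (y - x)) \<le> h y"
proof (rule ereal_le_real)
  fix r assume "h y \<le> ereal r"
  then have yr: "(y, r) \<in> ereal_epigraph h" by (simp add: ereal_epigraph_def)
  have xa: "(x, a) \<in> ereal_epigraph h" by (simp add: ereal_epigraph_def hx)
  define q where "q = (norm (y - x))\<^sup>2"
  have bound: "g \<bullet> (y - x) - c * t * q \<le> r - a" if t: "0 < t" "t \<le> 1" for t
  proof -
    have "(1 - t) *\<^sub>R (x, a) + t *\<^sub>R (y, r) \<in> ereal_epigraph h"
      using assms(1) xa yr t unfolding ereal_convex_def by (intro convexD) auto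
    then have "h (x + t *\<^sub>R (y - x)) \<le> ereal (a + t * (r - a))"
      by (simp add: ereal_epigraph_def algebra_simps)
    with minor[of "x + t *\<^sub>R (y - x)"]
    have "ereal (a + t * (g \<bullet> (y - x)) - c * (t\<^sup>2 * q)) \<le> ereal (a + t * (r - a))"
      using t order_trans by (force simp: q_def power_mult_distrib simp del: ereal_less_eq)
    then have "t * (g \<bullet> (y - x) - c * t * q) \<le> t * (r - a)"
      by (simp add: power2_eq_square algebra_simps)
    then show ?thesis using t by (simp add: mult_le_cancel_left)
  qed
  have "((\<lambda>t. g \<bullet> (y - x) - c * t * q) \<longlongrightarrow> g \<bullet> (y - x) - c * 0 * q) (at_right 0)"
    by (intro tendsto_intros)
  then have "g \<bullet> (y - x) - c * 0 * q \<le> r - a"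
  proof (rule tendsto_upperbound)
    show "\<forall>\<^sub>F t in at_right 0. g \<bullet> (y - x) - c * t * q \<le> r - a"
      using bound by (auto simp: eventually_at_right_field intro!: exI[of _ 1])
  qed simp
  then show "ereal (a + g \<bullet> (y - x)) \<le> ereal r" by simp
qed

text \<open>Subtracting \<open>\<mu> / 2 * (norm z)\<^sup>2\<close> turns the affine minorant of \<open>h\<close> into a quadratic minorant
  of a convex function that touches it at \<open>x\<close>, so the previous lemma removes its quadratic term.\<close>

lemma strongly_convex_lower_bound:
  fixes h :: "'a::real_inner \<Rightarrow> ereal"
  assumes "strongly_convex \<mu> h" and hx: "h x = ereal a"
    and minor: "\<And>z. ereal (a + g \<bullet> (z - x)) \<le> h z"
  shows "ereal (a + g \<bullet> (y - x) + \<mu> / 2 * (norm (y - x))\<^sup>2) \<le> h y"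
proof -
  let ?k = "\<lambda>z. h z - ereal (\<mu> / 2 * (norm z)\<^sup>2)"
  have quad: "(norm (z - x))\<^sup>2 = (norm z)\<^sup>2 - 2 * (x \<bullet> z) + (norm x)\<^sup>2" for z
    by (simp add: power2_norm_eq_inner inner_diff inner_commute)
  have "ereal (a - \<mu> / 2 * (norm x)\<^sup>2 + (g - \<mu> *\<^sub>R x) \<bullet> (y - x)) \<le> ?k y"
  proof (rule convex_quadratic_minorant_imp_affine[where c = "\<mu> / 2"])
    show "ereal_convex ?k" using assms(1) by (simp add: strongly_convex_def)
    show "?k x = ereal (a - \<mu> / 2 * (norm x)\<^sup>2)" by (simp add: hx)
    fix z
    have "ereal (a + g \<bullet> (z - x)) - ereal (\<mu> / 2 * (norm z)\<^sup>2) \<le> ?k z"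
      by (intro ereal_minus_mono minor order_refl)
    moreover have "a - \<mu> / 2 * (norm x)\<^sup>2 + (g - \<mu> *\<^sub>R x) \<bullet> (z - x) - \<mu> / 2 * (norm (z - x))\<^sup>2
        = a + g \<bullet> (z - x) - \<mu> / 2 * (norm z)\<^sup>2"
      unfolding quad by (simp add: inner_diff power2_norm_eq_inner inner_commute algebra_simps)
    ultimately show "ereal (a - \<mu> / 2 * (norm x)\<^sup>2 + (g - \<mu> *\<^sub>R x) \<bullet> (z - x)
        - \<mu> / 2 * (norm (z - x))\<^sup>2) \<le> ?k z" by (simp only: ereal_minus)
  qed
  then have "ereal (a - \<mu> / 2 * (norm x)\<^sup>2 + (g - \<mu> *\<^sub>R x) \<bullet> (y - x) + \<mu> / 2 * (norm y)\<^sup>2) \<le> h y"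
    by (cases "h y") auto
  moreover have "a - \<mu> / 2 * (norm x)\<^sup>2 + (g - \<mu> *\<^sub>R x) \<bullet> (y - x) + \<mu> / 2 * (norm y)\<^sup>2
      = a + g \<bullet> (y - x) + \<mu> / 2 * (norm (y - x))\<^sup>2"
    unfolding quad by (simp add: inner_diff power2_norm_eq_inner inner_commute field_simps)
  ultimately show ?thesis by (simp only:)
qed

section \<open>Smooth convex functions\<close>

text \<open>The point \<open>p\<close> minimizes \<open>h u + c / 2 * (norm (u - z))\<^sup>2\<close>. Minimizing the continuous function
  \<open>r + c / 2 * (norm (u - z))\<^sup>2\<close> over the pairs \<open>(u, r)\<close> of the closed epigraph avoids any
  semicontinuity argument; an affine minorant makes the sublevel sets compact. Minimality of \<open>p\<close> says
  that \<open>h\<close> has a concave quadratic minorant touching it at \<open>p\<close> with slope \<open>c *\<^sub>R (z - p)\<close>.\<close>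

lemma proximal_point_exists:
  fixes h :: "'a::euclidean_space \<Rightarrow> ereal"
  assumes "ereal_closed h" "ereal_proper h" "ereal_convex h"
    and g0: "g0 \<in> subdifferential h x0" and "0 < c"
  shows "\<exists>p. c *\<^sub>R (z - p) \<in> subdifferential h p"
proof -
  obtain a0 where a0: "h x0 = ereal a0" and low: "\<And>y. ereal (a0 + g0 \<bullet> (y - x0)) \<le> h y"
    using subdifferential_realE assms(2) g0 by blast
  define E where "E = ereal_epigraph h"
  define \<phi> where "\<phi> = (\<lambda>v::'a \<times> real. snd v + c / 2 * (norm (fst v - z))\<^sup>2)"
  define w where "w = z - (1 / c) *\<^sub>R g0"
  define T where "T = \<phi> (x0, a0)"
  define b where "b = a0 + g0 \<bullet> (z - x0) - (norm g0)\<^sup>2 / (2 * c)"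
  have E0: "(x0, a0) \<in> E" by (simp add: E_def ereal_epigraph_def a0)
  have affine: "a0 + g0 \<bullet> (fst v - x0) \<le> snd v" if "v \<in> E" for v
  proof -
    have "h (fst v) \<le> ereal (snd v)" using that by (auto simp: E_def ereal_epigraph_def)
    with low[of "fst v"] show ?thesis by (meson ereal_less_eq(3) order_trans)
  qed
  \<comment> \<open>Completing the square shows that the affine minorant makes the objective coercive.\<close>
  have square: "a0 + g0 \<bullet> (u - x0) + c / 2 * (norm (u - z))\<^sup>2 = b + c / 2 * (norm (u - w))\<^sup>2" for u
  proof -
    have g0_eq: "g0 = c *\<^sub>R (z - w)" using \<open>0 < c\<close> by (simp add: w_def)
    show ?thesis
      using \<open>0 < c\<close> unfolding b_def g0_eq
      by (simp add: power2_norm_eq_inner inner_diff inner_commute field_simps)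
  qed
  define R where "R = sqrt (2 * (T - b) / c)"
  define K where "K = E \<inter> {v. \<phi> v \<le> T}"
  have "bounded K"
  proof (rule bounded_subset)
    show "bounded (cball w R \<times> {a0 - norm g0 * (norm (w - x0) + R)..T})"
      by (intro bounded_Times) auto
    show "K \<subseteq> cball w R \<times> {a0 - norm g0 * (norm (w - x0) + R)..T}"
    proof
      fix v assume v: "v \<in> K"
      then have "b + c / 2 * (norm (fst v - w))\<^sup>2 \<le> T"
        using affine[of v] square[of "fst v"] by (auto simp: K_def \<phi>_def)
      then have "(norm (fst v - w))\<^sup>2 \<le> 2 * (T - b) / c"
        using \<open>0 < c\<close> by (simp add: field_simps)
      then have R: "norm (fst v - w) \<le> R" unfolding R_def by (rule real_le_rsqrt)
      have "norm (fst v - x0) \<le> norm (w - x0) + R"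
        using R norm_triangle_ineq[of "fst v - w" "w - x0"] by simp
      then have "norm g0 * norm (fst v - x0) \<le> norm g0 * (norm (w - x0) + R)"
        by (intro mult_left_mono) auto
      moreover have "- (norm g0 * norm (fst v - x0)) \<le> g0 \<bullet> (fst v - x0)"
        using Cauchy_Schwarz_ineq2[of g0 "fst v - x0"] by linarith
      ultimately have "a0 - norm g0 * (norm (w - x0) + R) \<le> snd v"
        using affine[of v] v by (auto simp: K_def)
      moreover have "0 \<le> c / 2 * (norm (fst v - z))\<^sup>2" using \<open>0 < c\<close> by simp
      then have "snd v \<le> T" using v by (auto simp: K_def \<phi>_def)
      ultimately show "v \<in> cball w R \<times> {a0 - norm g0 * (norm (w - x0) + R)..T}"
        using R by (cases v) (simp add: dist_norm norm_minus_commute)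
    qed
  qed
  moreover have cont: "continuous_on UNIV \<phi>" unfolding \<phi>_def by (intro continuous_intros)
  have "closed E" using assms(1) by (simp add: E_def ereal_closed_def)
  then have "closed K" unfolding K_def
    by (intro closed_Int closed_Collect_le cont continuous_on_const)
  ultimately have "compact K" by (simp add: compact_eq_bounded_closed)
  moreover have "K \<noteq> {}" using E0 by (auto simp: K_def T_def)
  moreover have "continuous_on K \<phi>" using cont continuous_on_subset by blast
  ultimately obtain v where v: "v \<in> K" and vmin: "\<And>u. u \<in> K \<Longrightarrow> \<phi> v \<le> \<phi> u"
    using continuous_attains_inf by metis
  have vE: "v \<in> E" using v by (simp add: K_def)
  have min: "\<phi> v \<le> \<phi> u" if "u \<in> E" for u
    using that v vmin[of u] by (cases "\<phi> u \<le> T") (auto simp: K_def)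
  define p where "p = fst v"
  have hp: "h p \<le> ereal (snd v)" using vE by (auto simp: p_def E_def ereal_epigraph_def)
  with low[of p] obtain a where a: "h p = ereal a" by (cases "h p") auto
  have "\<phi> v \<le> \<phi> (p, a)" by (rule min) (simp add: E_def ereal_epigraph_def a)
  then have va: "snd v = a" using hp a by (simp add: \<phi>_def p_def)
  have "ereal (a + (c *\<^sub>R (z - p)) \<bullet> (y - p)) \<le> h y" for y
  proof (rule convex_quadratic_minorant_imp_affine[where c = "c / 2"])
    show "ereal_convex h" by fact
    show "h p = ereal a" by fact
    fix u
    show "ereal (a + (c *\<^sub>R (z - p)) \<bullet> (u - p) - c / 2 * (norm (u - p))\<^sup>2) \<le> h u"
    proof (rule ereal_le_real)
      fix r assume "h u \<le> ereal r"
      then have "\<phi> v \<le> \<phi> (u, r)" by (intro min) (simp add: E_def ereal_epigraph_def)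
      then have "a + c / 2 * (norm (p - z))\<^sup>2 \<le> r + c / 2 * (norm (u - z))\<^sup>2"
        by (simp add: \<phi>_def va p_def)
      moreover have "(c *\<^sub>R (z - p)) \<bullet> (u - p) - c / 2 * (norm (u - p))\<^sup>2
          = c / 2 * (norm (p - z))\<^sup>2 - c / 2 * (norm (u - z))\<^sup>2"
        by (simp add: power2_norm_eq_inner inner_diff inner_commute field_simps)
      ultimately show "ereal (a + (c *\<^sub>R (z - p)) \<bullet> (u - p) - c / 2 * (norm (u - p))\<^sup>2) \<le> ereal r"
        by simp
    qed
  qed
  then show ?thesis using subdifferentialI a by blast
qed

lemma L_smooth_finiteD:
  assumes "L_smooth (ereal L) h" and "g \<in> subdifferential h x" and "g' \<in> subdifferential h x'"
  shows "norm (g - g') \<le> L * norm (x - x')"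
  using assms by (auto simp: L_smooth_def)

text \<open>If \<open>P z\<close> is a proximal point of \<open>z\<close> with parameter \<open>2 * L\<close>, then \<open>P\<close> is nonexpansive by
  monotonicity of the subdifferential, and \<open>z - P z\<close> is a subgradient at \<open>P z\<close> divided by \<open>2 * L\<close>.
  By smoothness \<open>z \<mapsto> z - P z\<close> is then a contraction with factor \<open>1 / 2\<close>, hence so is
  \<open>z \<mapsto> y + (z - P z)\<close>. Its fixed point has proximal point \<open>y\<close>, where \<open>h\<close> therefore has a subgradient.\<close>

lemma subdifferential_nonempty_if_smooth:
  fixes h :: "'a::euclidean_space \<Rightarrow> ereal"
  assumes h: "ereal_closed h" "ereal_proper h" "ereal_convex h"
    and smooth: "L_smooth (ereal L) h" and "0 < L" and g0: "g0 \<in> subdifferential h x0"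
  shows "\<exists>g. g \<in> subdifferential h y"
proof -
  obtain P where P: "\<And>z. (2 * L) *\<^sub>R (z - P z) \<in> subdifferential h (P z)"
    using proximal_point_exists[OF h g0, of "2 * L"] \<open>0 < L\<close> by (metis zero_less_mult_iff zero_less_numeral)
  have contr: "dist (y + (z - P z)) (y + (z' - P z')) \<le> 1 / 2 * dist z z'" for z z'
  proof -
    define e where "e = (z - P z) - (z' - P z')"
    have "norm ((2 * L) *\<^sub>R e) \<le> L * norm (P z - P z')"
      using L_smooth_finiteD[OF smooth P[of z] P[of z']] by (simp add: e_def scaleR_diff_right)
    then have e: "norm e \<le> 1 / 2 * norm (P z - P z')"
      using \<open>0 < L\<close> by (simp add: abs_mult field_simps)
    have "0 \<le> ((2 * L) *\<^sub>R e) \<bullet> (P z - P z')"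
      using subdifferential_monotone[OF h(2) P[of z] P[of z']] by (simp add: e_def algebra_simps)
    then have "0 \<le> e \<bullet> (P z - P z')" using \<open>0 < L\<close> by (simp add: zero_le_mult_iff)
    moreover have "(norm (e + (P z - P z')))\<^sup>2
        = (norm e)\<^sup>2 + 2 * (e \<bullet> (P z - P z')) + (norm (P z - P z'))\<^sup>2"
      by (simp add: power2_norm_eq_inner inner_add inner_commute)
    ultimately have "(norm (P z - P z'))\<^sup>2 \<le> (norm (e + (P z - P z')))\<^sup>2" by simp
    then have "norm (P z - P z') \<le> norm (e + (P z - P z'))" by (rule power2_le_imp_le) simp
    also have "e + (P z - P z') = z - z'" by (simp add: e_def)
    finally show ?thesis using e by (simp add: dist_norm e_def)
  qed
  have "\<exists>!z. y + (z - P z) = z"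
    using banach_fix_type[of "1 / 2" "\<lambda>z. y + (z - P z)"] contr by simp
  then obtain z where "P z = y" by (auto simp: algebra_simps)
  then show ?thesis using P by metis
qed

text \<open>In place of integrating the gradient along the segment from \<open>x\<close> to \<open>y\<close>, the segment is cut into \<open>m\<close>
  equal pieces. On each piece the subgradient at its far end bounds the increment of \<open>h\<close>, and the
  Lipschitz property compares this subgradient with \<open>g\<close>. The resulting Riemann sum exceeds the claimed
  bound by a term of order \<open>1 / m\<close>.\<close>

lemma smooth_upper_bound:
  fixes h :: "'a::euclidean_space \<Rightarrow> ereal"
  assumes h: "ereal_closed h" "ereal_proper h" "ereal_convex h"
    and smooth: "L_smooth (ereal L) h" and "0 < L" and g: "g \<in> subdifferential h x"
    and hx: "h x = ereal a"
  shows "h y \<le> ereal (a + g \<bullet> (y - x) + L / 2 * (norm (y - x))\<^sup>2)"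
proof -
  obtain G where G: "\<And>u. G u \<in> subdifferential h u"
    using subdifferential_nonempty_if_smooth[OF h smooth \<open>0 < L\<close> g] by metis
  define F where "F = (\<lambda>u. real_of_ereal (h u))"
  have F: "h u = ereal (F u)" for u
    using subdifferential_realE[OF h(2) G[of u]] by (metis F_def real_of_ereal.simps(1))
  have sub: "F u - F v \<le> G u \<bullet> (u - v)" for u v
    using G[of u] F by (auto simp: subdifferential_def inner_diff_right dest!: spec[of _ v])
  define d where "d = y - x"
  have G_along: "G (x + t *\<^sub>R d) \<bullet> d \<le> g \<bullet> d + L * t * (norm d)\<^sup>2" if "0 \<le> t" for t
  proof -
    have "norm (G (x + t *\<^sub>R d) - g) \<le> L * norm (x + t *\<^sub>R d - x)"
      by (rule L_smooth_finiteD[OF smooth G g])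
    then have "norm (G (x + t *\<^sub>R d) - g) * norm d \<le> L * (t * norm d) * norm d"
      using that by (intro mult_right_mono) auto
    then show ?thesis using norm_cauchy_schwarz[of "G (x + t *\<^sub>R d) - g" d]
      by (simp add: inner_diff_left power2_eq_square mult_ac)
  qed
  have sums: "F (x + (real i / real m) *\<^sub>R d) - F x
      \<le> real i / real m * (g \<bullet> d) + L * (norm d)\<^sup>2 * (real i * (real i + 1)) / (2 * (real m)\<^sup>2)"
    if "0 < m" for i m
  proof (induction i)
    case 0
    show ?case by simp
  next
    case (Suc i)
    let ?u = "x + (real (Suc i) / real m) *\<^sub>R d" and ?v = "x + (real i / real m) *\<^sub>R d"
    have "?u - ?v = (1 / real m) *\<^sub>R d"
      by (simp add: algebra_simps add_divide_distrib)
    then have "F ?u - F ?v \<le> 1 / real m * (G ?u \<bullet> d)" using sub[of ?u ?v] by simp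
    also have "\<dots> \<le> 1 / real m * (g \<bullet> d + L * (real (Suc i) / real m) * (norm d)\<^sup>2)"
      by (intro mult_left_mono G_along) auto
    finally have "F ?u - F x \<le> 1 / real m * (g \<bullet> d + L * (real (Suc i) / real m) * (norm d)\<^sup>2)
      + (real i / real m * (g \<bullet> d) + L * (norm d)\<^sup>2 * (real i * (real i + 1)) / (2 * (real m)\<^sup>2))"
      using Suc.IH by linarith
    also have "\<dots> = real (Suc i) / real m * (g \<bullet> d)
      + L * (norm d)\<^sup>2 * (real (Suc i) * (real (Suc i) + 1)) / (2 * (real m)\<^sup>2)"
      using that by (simp add: field_simps power2_eq_square)
    finally show ?case .
  qed
  have "F y - F x \<le> g \<bullet> d + L * (norm d)\<^sup>2 / 2 * (1 + 1 / real (Suc n))" for n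
  proof -
    have "F y - F x \<le> g \<bullet> d + L * (norm d)\<^sup>2 * (real (Suc n) * (real (Suc n) + 1)) / (2 * (real (Suc n))\<^sup>2)"
      using sums[of "Suc n" "Suc n"] by (simp add: d_def del: of_nat_Suc)
    also have "L * (norm d)\<^sup>2 * (s * (s + 1)) / (2 * s\<^sup>2) = L * (norm d)\<^sup>2 / 2 * (1 + 1 / s)"
      if "s = real (Suc n)" for s
    proof -
      have "s \<noteq> 0" using that by linarith
      then show ?thesis by (simp add: field_simps power2_eq_square)
    qed
    finally show ?thesis by simp
  qed
  moreover have "(\<lambda>n. g \<bullet> d + L * (norm d)\<^sup>2 / 2 * (1 + 1 / real (Suc n)))
      \<longlonglongrightarrow> g \<bullet> d + L * (norm d)\<^sup>2 / 2 * (1 + 0)"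
    by (intro tendsto_intros LIMSEQ_Suc[OF lim_1_over_n])
  ultimately have "F y - F x \<le> g \<bullet> d + L * (norm d)\<^sup>2 / 2 * (1 + 0)"
    by (intro tendsto_lowerbound[OF _ always_eventually]) auto
  moreover have "F x = a" using F[of x] hx by simp
  ultimately show ?thesis by (simp add: F d_def)
qed

definition smooth_recip :: "ereal \<Rightarrow> real" where
  "smooth_recip L = (if L = \<infinity> then 0 else 1 / real_of_ereal L)"

lemma smooth_recip_simps [simp]: "smooth_recip \<infinity> = 0" "smooth_recip (ereal l) = 1 / l"
  by (auto simp: smooth_recip_def)

lemma smooth_recip_Lipschitz:
  assumes "L_smooth L h" "0 < L" and "g \<in> subdifferential h x" and "g' \<in> subdifferential h x'"
  shows "smooth_recip L * norm (g - g') \<le> norm (x - x')"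
proof (cases L)
  case (real l)
  then show ?thesis
    using L_smooth_finiteD[of l h g x g' x'] assms by (simp add: field_simps)
qed (use assms in auto)

text \<open>The left-hand side is what is obtained by squeezing \<open>h\<close> at a third point \<open>w\<close> between the quadratic
  lower bound based at \<open>x\<close>, of curvature \<open>\<mu>\<close>, and the quadratic upper bound based at \<open>y\<close>, of curvature
  \<open>L\<close>, and then choosing \<open>w\<close> to maximize the difference of the two bounds. Multiplication by
  \<open>1 - \<mu> * \<iota>\<close> and the use of \<open>\<iota> = 1 / L\<close> make the inequality meaningful for \<open>L = \<infinity>\<close>, where it is
  the strong convexity bound.\<close>

lemma subgradient_gap_bound:
  fixes h :: "'a::euclidean_space \<Rightarrow> ereal"
  assumes h: "ereal_closed h" "ereal_proper h" "ereal_convex h"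
    and smooth: "L_smooth L h" and strong: "strongly_convex \<mu> h"
    and "0 < L" and \<mu>L: "\<mu> * smooth_recip L < 1"
    and gx: "gx \<in> subdifferential h x" and gy: "gy \<in> subdifferential h y"
    and hx: "h x = ereal a" and hy: "h y = ereal b"
  defines "\<iota> \<equiv> smooth_recip L"
  shows "\<iota> * (norm (gy - gx))\<^sup>2 + \<mu> * (norm (y - x))\<^sup>2 - 2 * \<mu> * \<iota> * ((gy - gx) \<bullet> (y - x))
    \<le> 2 * (1 - \<mu> * \<iota>) * (b - a - gx \<bullet> (y - x))"
proof -
  have minor: "ereal (a + gx \<bullet> (z - x)) \<le> h z" for z
    using gx hx by (simp add: subdifferential_def)
  note lower = strongly_convex_lower_bound[OF strong hx minor]
  show ?thesis
  proof (cases L)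
    case PInf
    then show ?thesis using lower[of y] hy by (simp add: \<iota>_def)
  next
    case (real l)
    with \<open>0 < L\<close> have "0 < l" by simp
    have \<iota>: "\<iota> = 1 / l" by (simp add: \<iota>_def real)
    have "\<mu> < l" using \<mu>L \<open>0 < l\<close> by (simp add: real field_simps)
    \<comment> \<open>The stationary point of the difference of the two bounds is \<open>y + s *\<^sub>R \<delta>\<close>.\<close>
    define \<delta> where "\<delta> = gx - gy + \<mu> *\<^sub>R (y - x)"
    define s where "s = 1 / (l - \<mu>)"
    let ?w = "y + s *\<^sub>R \<delta>"
    have upper: "h ?w \<le> ereal (b + gy \<bullet> (?w - y) + l / 2 * (norm (?w - y))\<^sup>2)"
      using smooth real by (intro smooth_upper_bound[OF h _ \<open>0 < l\<close> gy hy]) simp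
    have "ereal (a + gx \<bullet> (?w - x) + \<mu> / 2 * (norm (?w - x))\<^sup>2)
        \<le> ereal (b + gy \<bullet> (?w - y) + l / 2 * (norm (?w - y))\<^sup>2)"
      using order_trans[OF lower upper] .
    then have le: "a + gx \<bullet> (?w - x) + \<mu> / 2 * (norm (?w - x))\<^sup>2
        \<le> b + gy \<bullet> (?w - y) + l / 2 * (norm (?w - y))\<^sup>2" by simp
    have "?w - x = (y - x) + s *\<^sub>R \<delta>" by simp
    then have sq: "(norm (?w - x))\<^sup>2 = (norm (y - x))\<^sup>2 + 2 * s * ((y - x) \<bullet> \<delta>) + s\<^sup>2 * (norm \<delta>)\<^sup>2"
      by (simp only: power2_norm_eq_inner) (simp add: inner_add inner_commute power2_eq_square)
    have lin: "gx \<bullet> (?w - x) = gx \<bullet> (y - x) + s * (gx \<bullet> \<delta>)"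
      by (simp add: inner_add_right inner_diff_right)
    have le: "s * ((gx - gy) \<bullet> \<delta> + \<mu> * ((y - x) \<bullet> \<delta>)) - (l - \<mu>) / 2 * (s\<^sup>2 * (norm \<delta>)\<^sup>2)
        + \<mu> / 2 * (norm (y - x))\<^sup>2 \<le> b - a - gx \<bullet> (y - x)"
      using le[unfolded sq lin] by (simp add: inner_diff_left power_mult_distrib field_simps)
    have "(gx - gy) \<bullet> \<delta> + \<mu> * ((y - x) \<bullet> \<delta>) = \<delta> \<bullet> \<delta>"
      by (simp add: \<delta>_def inner_add_left)
    then have "(gx - gy) \<bullet> \<delta> + \<mu> * ((y - x) \<bullet> \<delta>) = (norm \<delta>)\<^sup>2"
      by (simp add: power2_norm_eq_inner)
    moreover have "(l - \<mu>) * s = 1" using \<open>\<mu> < l\<close> by (simp add: s_def)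
    then have "(l - \<mu>) / 2 * (s\<^sup>2 * (norm \<delta>)\<^sup>2) = s / 2 * (norm \<delta>)\<^sup>2"
      by (simp add: power2_eq_square)
    ultimately have "s * (norm \<delta>)\<^sup>2 - s / 2 * (norm \<delta>)\<^sup>2 + \<mu> / 2 * (norm (y - x))\<^sup>2
        \<le> b - a - gx \<bullet> (y - x)"
      using le by (simp only:)
    then have "s / 2 * (norm \<delta>)\<^sup>2 + \<mu> / 2 * (norm (y - x))\<^sup>2 \<le> b - a - gx \<bullet> (y - x)"
      by (simp add: field_simps)
    then have "2 * (1 - \<mu> * \<iota>) * (s / 2 * (norm \<delta>)\<^sup>2 + \<mu> / 2 * (norm (y - x))\<^sup>2)
        \<le> 2 * (1 - \<mu> * \<iota>) * (b - a - gx \<bullet> (y - x))"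
      using \<mu>L by (intro mult_left_mono) (auto simp: \<iota>_def)
    moreover have "2 * (1 - \<mu> * \<iota>) * (s / 2 * n + \<mu> / 2 * q) = \<iota> * (n + \<mu> * (l - \<mu>) * q)" for n q
      using \<open>0 < l\<close> \<open>\<mu> < l\<close> by (simp add: \<iota> s_def field_simps)
    moreover have \<delta>_sq: "(norm \<delta>)\<^sup>2 = (norm (gy - gx))\<^sup>2 - 2 * \<mu> * ((gy - gx) \<bullet> (y - x))
        + \<mu>\<^sup>2 * (norm (y - x))\<^sup>2"
      unfolding \<delta>_def power2_norm_eq_inner
      by (simp add: inner_add inner_diff inner_commute power2_eq_square algebra_simps)
    have "\<iota> * ((norm \<delta>)\<^sup>2 + \<mu> * (l - \<mu>) * (norm (y - x))\<^sup>2)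
        = \<iota> * (norm (gy - gx))\<^sup>2 + \<mu> * (norm (y - x))\<^sup>2 - 2 * \<mu> * \<iota> * ((gy - gx) \<bullet> (y - x))"
      unfolding \<delta>_sq using \<open>0 < l\<close> by (simp add: \<iota> field_simps power2_eq_square)
    ultimately show ?thesis by (simp only:)
  qed (use \<open>0 < L\<close> in auto)
qed

section \<open>Decrease of the objective in one iteration\<close>

text \<open>With \<open>\<iota> = 1 / L\<close> and \<open>\<kappa> = 1 / L'\<close> for \<open>L \<ge> L'\<close>, this is the decrease per unit of \<open>m\<^sup>2\<close> in one iteration,
  where \<open>L\<close> and \<open>\<mu>\<close> belong to the function whose strong convexity is used. In terms of \<open>L\<close> and \<open>L'\<close>
  it reads \<open>(L + L' + \<mu> * (L / L' - 3)) / (2 * L' * (L - \<mu>))\<close>, the quotient of the constants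
  \<open>rate_B\<close> and \<open>rate_A\<close>.\<close>

definition gain :: "real \<Rightarrow> real \<Rightarrow> real \<Rightarrow> real" where
  "gain \<mu> \<iota> \<kappa> = (\<iota> + \<kappa> + \<mu> * \<kappa>\<^sup>2 - 3 * \<mu> * \<iota> * \<kappa>) / (2 * (1 - \<mu> * \<iota>))"

definition dca_gain :: "real \<Rightarrow> real \<Rightarrow> real \<Rightarrow> real \<Rightarrow> real" where
  "dca_gain \<mu>1 \<mu>2 \<iota>1 \<iota>2 = (if \<iota>1 \<le> \<iota>2 then gain \<mu>1 \<iota>1 \<iota>2 else gain \<mu>2 \<iota>2 \<iota>1)"

text \<open>The fraction is the share of the function whose strong convexity is used, the term \<open>\<kappa> / 2\<close> that of
  the other function. For \<open>0 \<le> \<mu>\<close>, \<open>0 \<le> \<iota> \<le> \<kappa>\<close> and \<open>\<mu> * \<kappa> < 1\<close> all summands are visibly nonnegative.\<close>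

lemma gain_split:
  assumes "\<mu> * \<iota> < 1"
  shows "gain \<mu> \<iota> \<kappa> = (\<iota> * (1 - \<mu> * \<kappa>) + \<mu> * \<kappa> * (\<kappa> - \<iota>)) / (2 * (1 - \<mu> * \<iota>)) + \<kappa> / 2"
  using assms by (simp add: gain_def field_simps power2_eq_square)

lemma mult_le_less_one:
  fixes \<mu> \<iota> \<kappa> :: real
  assumes "0 \<le> \<mu>" "\<iota> \<le> \<kappa>" "\<mu> * \<kappa> < 1"
  shows "\<mu> * \<iota> < 1"
  using mult_left_mono[of \<iota> \<kappa> \<mu>] assms by linarith

lemma gain_pos:
  assumes "0 \<le> \<mu>" "0 \<le> \<iota>" "\<iota> \<le> \<kappa>" "0 < \<kappa>" "\<mu> * \<kappa> < 1"
  shows "0 < gain \<mu> \<iota> \<kappa>"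
proof -
  have "\<mu> * \<iota> < 1" using assms mult_le_less_one by blast
  then show ?thesis unfolding gain_split[OF \<open>\<mu> * \<iota> < 1\<close>]
    using assms by (intro add_nonneg_pos divide_nonneg_pos add_nonneg_nonneg mult_nonneg_nonneg) auto
qed

text \<open>Here \<open>D\<close> and \<open>D'\<close> are the gaps of the functions with the larger and the smaller smoothness constant.
  The mixed term \<open>\<delta> \<bullet> d\<close> in the bound for \<open>D\<close> is split by Young's inequality. Since \<open>\<iota> \<le> \<kappa>\<close>, a
  nonnegative multiple of \<open>(norm d)\<^sup>2\<close> is left, and the Lipschitz bound converts it into a multiple of
  \<open>(norm \<delta>')\<^sup>2\<close>. Since \<open>\<mu> * \<kappa> < 1\<close>, the coefficient left for \<open>(norm \<delta>)\<^sup>2\<close> is nonnegative as well.\<close>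

lemma gap_sum_ge_gain:
  fixes \<delta> \<delta>' d :: "'a::real_inner"
  assumes pos: "0 \<le> \<mu>" "0 \<le> \<iota>" "\<iota> \<le> \<kappa>" "0 < \<kappa>" "\<mu> * \<kappa> < 1"
    and D: "\<iota> * (norm \<delta>)\<^sup>2 + \<mu> * (norm d)\<^sup>2 - 2 * \<mu> * \<iota> * (\<delta> \<bullet> d) \<le> 2 * (1 - \<mu> * \<iota>) * D"
    and D': "\<kappa> * (norm \<delta>')\<^sup>2 \<le> 2 * D'"
    and Lip: "\<kappa> * norm \<delta>' \<le> norm d"
    and m: "0 \<le> m" "m \<le> norm \<delta>" "m \<le> norm \<delta>'"
  shows "gain \<mu> \<iota> \<kappa> * m\<^sup>2 \<le> D + D'"
proof -
  have \<mu>\<iota>: "\<mu> * \<iota> < 1" using pos mult_le_less_one by blast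
  have m2: "m\<^sup>2 \<le> (norm \<delta>)\<^sup>2" "m\<^sup>2 \<le> (norm \<delta>')\<^sup>2" using m by (auto intro: power_mono)
  have "\<kappa> * m \<le> norm d"
    using Lip mult_left_mono[OF m(3), of \<kappa>] pos by linarith
  then have "(\<kappa> * m)\<^sup>2 \<le> (norm d)\<^sup>2"
    using m pos by (intro power_mono) auto
  then have d: "\<kappa>\<^sup>2 * m\<^sup>2 \<le> (norm d)\<^sup>2" by (simp add: power_mult_distrib)
  \<comment> \<open>The weights of Young's inequality are those for which it is tight at \<open>d = \<kappa> *\<^sub>R \<delta>\<close>; there the
    Lipschitz bound is tight too if \<open>norm \<delta> = norm \<delta>'\<close>.\<close>
  have "0 \<le> (norm (\<kappa> *\<^sub>R \<delta> - d))\<^sup>2" by simp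
  then have "2 * \<kappa> * (\<delta> \<bullet> d) \<le> \<kappa>\<^sup>2 * (norm \<delta>)\<^sup>2 + (norm d)\<^sup>2"
    by (simp add: power2_norm_eq_inner inner_diff inner_commute power2_eq_square[of \<kappa>] algebra_simps)
  then have young: "(\<mu> * \<iota>) * (2 * \<kappa> * (\<delta> \<bullet> d)) \<le> (\<mu> * \<iota>) * (\<kappa>\<^sup>2 * (norm \<delta>)\<^sup>2 + (norm d)\<^sup>2)"
    using pos by (intro mult_left_mono) auto
  have "\<kappa> * ((\<iota> * (1 - \<mu> * \<kappa>) + \<mu> * \<kappa> * (\<kappa> - \<iota>)) * m\<^sup>2)
      = \<kappa> * \<iota> * (1 - \<mu> * \<kappa>) * m\<^sup>2 + \<mu> * (\<kappa> - \<iota>) * (\<kappa>\<^sup>2 * m\<^sup>2)"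
    by (simp add: algebra_simps power2_eq_square)
  also have "\<dots> \<le> \<kappa> * \<iota> * (1 - \<mu> * \<kappa>) * (norm \<delta>)\<^sup>2 + \<mu> * (\<kappa> - \<iota>) * (norm d)\<^sup>2"
    using pos d m2 by (intro add_mono mult_left_mono) auto
  also have "\<dots> \<le> \<kappa> * (\<iota> * (norm \<delta>)\<^sup>2 + \<mu> * (norm d)\<^sup>2 - 2 * \<mu> * \<iota> * (\<delta> \<bullet> d))"
    using young by (simp add: algebra_simps power2_eq_square)
  also have "\<dots> \<le> \<kappa> * (2 * (1 - \<mu> * \<iota>) * D)"
    using D pos by (intro mult_left_mono) auto
  finally have "(\<iota> * (1 - \<mu> * \<kappa>) + \<mu> * \<kappa> * (\<kappa> - \<iota>)) * m\<^sup>2 \<le> 2 * (1 - \<mu> * \<iota>) * D"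
    using pos by simp
  then have "(\<iota> * (1 - \<mu> * \<kappa>) + \<mu> * \<kappa> * (\<kappa> - \<iota>)) / (2 * (1 - \<mu> * \<iota>)) * m\<^sup>2 \<le> D"
    using \<mu>\<iota> by (simp add: pos_divide_le_eq mult_ac)
  moreover have "\<kappa> / 2 * m\<^sup>2 \<le> D'"
    using D' mult_left_mono[OF m2(2) less_imp_le[OF pos(4)]] by simp
  ultimately show ?thesis
    unfolding gain_split[OF \<mu>\<iota>] by (simp add: distrib_right)
qed

text \<open>The decrease is \<open>D1 + D2\<close>, the gap of \<open>f1\<close> at \<open>x\<close> as seen from \<open>x'\<close> plus the gap of \<open>f2\<close> at \<open>x'\<close> as
  seen from \<open>x\<close>. The roles of the two functions in \<open>gap_sum_ge_gain\<close> depend on which smoothness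
  constant is larger; the function in the second role enters
  only through its convexity and smoothness.\<close>

lemma dca_step_decrease:
  fixes f1 f2 :: "'a::euclidean_space \<Rightarrow> ereal"
  assumes F1: "f1 \<in> F_class \<mu>1 L1" and F2: "f2 \<in> F_class \<mu>2 L2"
    and L: "0 < L1" "0 < L2" "L1 < \<infinity> \<or> L2 < \<infinity>" and \<mu>: "0 \<le> \<mu>1" "0 \<le> \<mu>2"
    and \<mu>L: "\<mu>1 * smooth_recip L2 < 1" "\<mu>2 * smooth_recip L1 < 1"
    and sub: "h \<in> subdifferential f1 x" "g \<in> subdifferential f2 x"
      "g \<in> subdifferential f1 x'" "g' \<in> subdifferential f2 x'"
    and val: "f1 x = ereal a1" "f2 x = ereal a2" "f1 x' = ereal a1'" "f2 x' = ereal a2'"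
    and m: "0 \<le> m" "m \<le> norm (h - g)" "m \<le> norm (g - g')"
  shows "dca_gain \<mu>1 \<mu>2 (smooth_recip L1) (smooth_recip L2) * m\<^sup>2 \<le> (a1 - a2) - (a1' - a2')"
proof -
  define \<iota>1 \<iota>2 where "\<iota>1 = smooth_recip L1" and "\<iota>2 = smooth_recip L2"
  have pos: "0 \<le> \<iota>1" "0 \<le> \<iota>2" "0 < \<iota>1 \<or> 0 < \<iota>2"
    using L by (cases L1; cases L2; simp add: \<iota>1_def \<iota>2_def)+
  note F1' = F1[unfolded F_class_def, simplified] and F2' = F2[unfolded F_class_def, simplified]
  define D1 where "D1 = a1 - a1' - g \<bullet> (x - x')"
  define D2 where "D2 = a2' - a2 - g \<bullet> (x' - x)"
  have D: "(a1 - a2) - (a1' - a2') = D1 + D2"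
    by (simp add: D1_def D2_def inner_diff_right)
  have gap1: "\<iota>1 * (norm (h - g))\<^sup>2 + \<mu> * (norm (x - x'))\<^sup>2 - 2 * \<mu> * \<iota>1 * ((h - g) \<bullet> (x - x'))
      \<le> 2 * (1 - \<mu> * \<iota>1) * D1" if "strongly_convex \<mu> f1" "\<mu> * \<iota>1 < 1" for \<mu>
    unfolding D1_def \<iota>1_def using F1' L sub val that[unfolded \<iota>1_def]
    by (intro subgradient_gap_bound[where h = f1]) auto
  have gap2: "\<iota>2 * (norm (g' - g))\<^sup>2 + \<mu> * (norm (x' - x))\<^sup>2 - 2 * \<mu> * \<iota>2 * ((g' - g) \<bullet> (x' - x))
      \<le> 2 * (1 - \<mu> * \<iota>2) * D2" if "strongly_convex \<mu> f2" "\<mu> * \<iota>2 < 1" for \<mu>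
    unfolding D2_def \<iota>2_def using F2' L sub val that[unfolded \<iota>2_def]
    by (intro subgradient_gap_bound[where h = f2]) auto
  have zero: "strongly_convex 0 f1" "strongly_convex 0 f2"
    using F1' F2' by (auto simp: strongly_convex_def zero_ereal_def[symmetric])
  have lip1: "\<iota>1 * norm (h - g) \<le> norm (x - x')"
    unfolding \<iota>1_def using F1' L sub by (intro smooth_recip_Lipschitz) auto
  have lip2: "\<iota>2 * norm (g' - g) \<le> norm (x' - x)"
    unfolding \<iota>2_def using F2' L sub by (intro smooth_recip_Lipschitz) auto
  show ?thesis
  proof (cases "\<iota>1 \<le> \<iota>2")
    case True
    have "gain \<mu>1 \<iota>1 \<iota>2 * m\<^sup>2 \<le> D1 + D2"
    proof (rule gap_sum_ge_gain)
      have "\<mu>1 * \<iota>1 < 1" using True \<mu> \<mu>L mult_le_less_one \<iota>2_def by blast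
      then show "\<iota>1 * (norm (h - g))\<^sup>2 + \<mu>1 * (norm (x - x'))\<^sup>2 - 2 * \<mu>1 * \<iota>1 * ((h - g) \<bullet> (x - x'))
        \<le> 2 * (1 - \<mu>1 * \<iota>1) * D1" using gap1 F1' by auto
      show "\<iota>2 * (norm (g - g'))\<^sup>2 \<le> 2 * D2"
        using gap2[OF zero(2)] by (simp add: norm_minus_commute)
      show "\<iota>2 * norm (g - g') \<le> norm (x - x')" using lip2 by (simp add: norm_minus_commute)
    qed (use True pos \<mu> \<mu>L m in \<open>auto simp: \<iota>2_def\<close>)
    with True D show ?thesis by (simp add: dca_gain_def \<iota>1_def \<iota>2_def)
  next
    case False
    have "gain \<mu>2 \<iota>2 \<iota>1 * m\<^sup>2 \<le> D2 + D1"
    proof (rule gap_sum_ge_gain)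
      have "\<mu>2 * \<iota>2 < 1" using False \<mu> \<mu>L mult_le_less_one[of \<mu>2 \<iota>2 \<iota>1] \<iota>1_def by auto
      then show "\<iota>2 * (norm (g' - g))\<^sup>2 + \<mu>2 * (norm (x' - x))\<^sup>2 - 2 * \<mu>2 * \<iota>2 * ((g' - g) \<bullet> (x' - x))
        \<le> 2 * (1 - \<mu>2 * \<iota>2) * D2" using gap2 F2' by auto
      show "\<iota>1 * (norm (h - g))\<^sup>2 \<le> 2 * D1"
        using gap1[OF zero(1)] by simp
      show "\<iota>1 * norm (h - g) \<le> norm (x' - x)" using lip1 by (simp add: norm_minus_commute)
    qed (use False pos \<mu> \<mu>L m in \<open>auto simp: \<iota>1_def norm_minus_commute\<close>)
    with False D show ?thesis by (simp add: dca_gain_def \<iota>1_def \<iota>2_def)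
  qed
qed

text \<open>For finite \<open>L1\<close>, \<open>f1 - f2\<close> is bounded above by a quadratic function with slope \<open>h - g\<close> at \<open>x\<close> and
  curvature \<open>L1 - \<mu>2\<close>; the estimate evaluates it at its minimizer. For \<open>L1 = \<infinity>\<close> the factor on the left
  vanishes.\<close>

lemma criticality_gap_bound:
  fixes f1 f2 :: "'a::euclidean_space \<Rightarrow> ereal"
  assumes F1: "f1 \<in> F_class \<mu>1 L1" and F2: "f2 \<in> F_class \<mu>2 L2"
    and "0 < L1" and \<mu>L: "\<mu>2 * smooth_recip L1 < 1"
    and sub: "h \<in> subdifferential f1 x" "g \<in> subdifferential f2 x"
    and val: "f1 x = ereal a1" "f2 x = ereal a2"
    and low: "\<And>y. ereal fstar \<le> dc_diff f1 f2 y"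
  shows "smooth_recip L1 / (2 * (1 - \<mu>2 * smooth_recip L1)) * (norm (h - g))\<^sup>2 \<le> a1 - a2 - fstar"
proof (cases L1)
  case PInf
  then show ?thesis using low[of x] val by (simp add: dc_diff_def)
next
  case (real l)
  with \<open>0 < L1\<close> have "0 < l" by simp
  have "\<mu>2 < l" using \<mu>L \<open>0 < l\<close> by (simp add: real field_simps)
  note F1' = F1[unfolded F_class_def, simplified] and F2' = F2[unfolded F_class_def, simplified]
  define s where "s = 1 / (l - \<mu>2)"
  define d where "d = - (s *\<^sub>R (h - g))"
  let ?y = "x + d"
  have "f1 ?y \<le> ereal (a1 + h \<bullet> (?y - x) + l / 2 * (norm (?y - x))\<^sup>2)"
    using F1' real sub val \<open>0 < l\<close> by (intro smooth_upper_bound) auto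
  then have up: "f1 ?y \<le> ereal (a1 + h \<bullet> d + l / 2 * (norm d)\<^sup>2)" by simp
  have "ereal (a2 + g \<bullet> (?y - x) + \<mu>2 / 2 * (norm (?y - x))\<^sup>2) \<le> f2 ?y"
    using F2' sub val by (intro strongly_convex_lower_bound) (auto simp: subdifferential_def)
  then have lo: "ereal (a2 + g \<bullet> d + \<mu>2 / 2 * (norm d)\<^sup>2) \<le> f2 ?y" by simp
  have "ereal fstar \<le> f1 ?y - f2 ?y"
    using low[of ?y] up by (auto simp: dc_diff_def split: if_splits)
  also have "\<dots> \<le> ereal (a1 + h \<bullet> d + l / 2 * (norm d)\<^sup>2) - ereal (a2 + g \<bullet> d + \<mu>2 / 2 * (norm d)\<^sup>2)"
    using up lo by (rule ereal_minus_mono)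
  finally have "fstar \<le> a1 - a2 + (h - g) \<bullet> d + (l - \<mu>2) / 2 * (norm d)\<^sup>2"
    by (simp add: inner_diff_left field_simps)
  moreover have "(h - g) \<bullet> d = - (s * (norm (h - g))\<^sup>2)"
    by (simp add: d_def power2_norm_eq_inner)
  moreover have "(l - \<mu>2) * s = 1" using \<open>\<mu>2 < l\<close> by (simp add: s_def)
  then have "(l - \<mu>2) / 2 * (norm d)\<^sup>2 = s / 2 * (norm (h - g))\<^sup>2"
    by (simp add: d_def power_mult_distrib power2_eq_square)
  moreover have "smooth_recip L1 / (2 * (1 - \<mu>2 * smooth_recip L1)) = s / 2"
    using \<open>0 < l\<close> \<open>\<mu>2 < l\<close> by (simp add: real s_def field_simps)
  ultimately show ?thesis by (simp only:)
qed (use \<open>0 < L1\<close> in auto)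

section \<open>The rate in reciprocal constants\<close>

lemma gain_tendsto:
  assumes "(f \<longlongrightarrow> \<iota>) F" "(g \<longlongrightarrow> \<kappa>) F" "\<mu> * \<iota> \<noteq> 1"
  shows "((\<lambda>t. gain \<mu> (f t) (g t)) \<longlongrightarrow> gain \<mu> \<iota> \<kappa>) F"
  unfolding gain_def using assms by (intro tendsto_intros) auto

text \<open>The total of the \<open>N\<close> iterations and of the final estimate, per unit of \<open>m\<^sup>2\<close>. It is the
  reciprocal of \<open>rate_quotient\<close>, as a function of the reciprocal smoothness constants.\<close>

definition recip_rate :: "real \<Rightarrow> real \<Rightarrow> nat \<Rightarrow> real \<Rightarrow> real \<Rightarrow> real" where
  "recip_rate \<mu>1 \<mu>2 N \<iota>1 \<iota>2 =
     real N * dca_gain \<mu>1 \<mu>2 \<iota>1 \<iota>2 + \<iota>1 / (2 * (1 - \<mu>2 * \<iota>1))"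

lemma dca_gain_pos:
  assumes "0 \<le> \<mu>1" "0 \<le> \<mu>2" "0 \<le> \<iota>1" "0 \<le> \<iota>2" "0 < \<iota>1 \<or> 0 < \<iota>2" "\<mu>1 * \<iota>2 < 1" "\<mu>2 * \<iota>1 < 1"
  shows "0 < dca_gain \<mu>1 \<mu>2 \<iota>1 \<iota>2"
  using assms by (auto simp: dca_gain_def intro!: gain_pos)

lemma recip_rate_pos:
  assumes "0 \<le> \<mu>1" "0 \<le> \<mu>2" "0 \<le> \<iota>1" "0 \<le> \<iota>2" "0 < \<iota>1 \<or> 0 < \<iota>2" "\<mu>1 * \<iota>2 < 1" "\<mu>2 * \<iota>1 < 1"
    and "1 \<le> N"
  shows "0 < recip_rate \<mu>1 \<mu>2 N \<iota>1 \<iota>2"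
  unfolding recip_rate_def
  using assms dca_gain_pos[OF assms(1-7)]
  by (intro add_pos_nonneg mult_pos_pos divide_nonneg_pos) auto

lemma recip_rate_tendsto:
  assumes "((\<lambda>t. dca_gain \<mu>1 \<mu>2 (i t) (k t)) \<longlongrightarrow> dca_gain \<mu>1 \<mu>2 \<iota>1 \<iota>2) F"
    and "(i \<longlongrightarrow> \<iota>1) F" and "\<mu>2 * \<iota>1 \<noteq> 1"
  shows "((\<lambda>t. recip_rate \<mu>1 \<mu>2 N (i t) (k t)) \<longlongrightarrow> recip_rate \<mu>1 \<mu>2 N \<iota>1 \<iota>2) F"
  unfolding recip_rate_def using assms by (intro tendsto_intros) auto

text \<open>The numerator \<open>rate_A\<close> of the quotient \<open>finite_rate\<close> is also a factor of its denominator. It vanishes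
  exactly for \<open>L1 = L2 = \<mu>1 + \<mu>2\<close>, which explains the indeterminate form \<open>0 / 0\<close> in that case:
  \<open>recip_rate\<close> has no singularity there.\<close>

lemma rate_denom_eq:
  assumes "0 < L1" "0 < L2" "\<mu>1 < L2" "\<mu>2 < L1"
  shows "rate_denom L1 L2 \<mu>1 \<mu>2 N = rate_A L1 L2 \<mu>1 \<mu>2 * recip_rate \<mu>1 \<mu>2 N (1 / L1) (1 / L2)"
proof -
  have B: "rate_B L1 L2 \<mu>1 \<mu>2 = rate_A L1 L2 \<mu>1 \<mu>2 * dca_gain \<mu>1 \<mu>2 (1 / L1) (1 / L2)"
  proof (cases L1 L2 rule: linorder_cases)
    case less
    then have "dca_gain \<mu>1 \<mu>2 (1 / L1) (1 / L2) = gain \<mu>2 (1 / L2) (1 / L1)"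
      using assms by (simp add: dca_gain_def field_simps)
    then show ?thesis using less assms
      by (simp add: rate_A_def rate_B_def gain_def divide_simps power2_eq_square) algebra
  next
    case equal
    then have "dca_gain \<mu>1 \<mu>2 (1 / L1) (1 / L2) = 1 / L1"
      using assms by (simp add: dca_gain_def gain_def field_simps power2_eq_square)
    then show ?thesis using equal assms by (simp only:) (simp add: rate_A_def rate_B_def field_simps)
  next
    case greater
    then have "dca_gain \<mu>1 \<mu>2 (1 / L1) (1 / L2) = gain \<mu>1 (1 / L1) (1 / L2)"
      using assms by (simp add: dca_gain_def field_simps)
    then show ?thesis using greater assms
      by (simp add: rate_A_def rate_B_def gain_def divide_simps power2_eq_square) algebra
  qed
  have recip: "(1 / L1) / (2 * (1 - \<mu>2 * (1 / L1))) = 1 / (2 * (L1 - \<mu>2))"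
    using assms by (simp add: field_simps)
  have cancel: "r / d = 2 * r * (1 / (2 * d))" for r d :: real by simp
  have C: "rate_C L1 L2 \<mu>1 \<mu>2 = rate_A L1 L2 \<mu>1 \<mu>2 * ((1 / L1) / (2 * (1 - \<mu>2 * (1 / L1))))"
    unfolding rate_C_def rate_A_def recip by (rule cancel)
  show ?thesis
    unfolding rate_denom_def recip_rate_def B C by (simp only: distrib_left mult_ac)
qed

lemma finite_rate_eq:
  assumes "0 < L1" "0 < L2" "\<mu>1 < L2" "\<mu>2 < L1"
    and "rate_A L1 L2 \<mu>1 \<mu>2 \<noteq> 0"
  shows "finite_rate L1 L2 \<mu>1 \<mu>2 N = 1 / recip_rate \<mu>1 \<mu>2 N (1 / L1) (1 / L2)"
  using assms by (simp add: finite_rate_def rate_denom_eq)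

lemma finite_rate_eq_distinct:
  assumes "0 < L1" "0 < L2" "\<mu>1 < L2" "\<mu>2 < L1" and "L1 \<noteq> L2"
  shows "finite_rate L1 L2 \<mu>1 \<mu>2 N = 1 / recip_rate \<mu>1 \<mu>2 N (1 / L1) (1 / L2)"
proof (rule finite_rate_eq[OF assms(1-4)])
  show "rate_A L1 L2 \<mu>1 \<mu>2 \<noteq> 0"
  proof (cases "L1 < L2")
    case True
    then have "rate_A L1 L2 \<mu>1 \<mu>2 = 2 * (L1 * (L2 - \<mu>2))" by (simp add: rate_A_def algebra_simps)
    then show ?thesis using True assms by simp
  next
    case False
    then have "rate_A L1 L2 \<mu>1 \<mu>2 = 2 * (L2 * (L1 - \<mu>1))"
      using assms by (simp add: rate_A_def algebra_simps)
    then show ?thesis using False assms by simp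
  qed
qed

lemma recip_at_top: "((\<lambda>l::real. 1 / l) \<longlongrightarrow> 0) at_top"
  using tendsto_inverse_0_at_top[OF filterlim_ident] by (simp add: inverse_eq_divide)

lemma finite_rate_tendsto_L1_infinite:
  assumes "0 \<le> \<mu>1" "0 \<le> \<mu>2" "0 < L2" "\<mu>1 < L2" "1 \<le> N"
  shows "((\<lambda>l. finite_rate l L2 \<mu>1 \<mu>2 N) \<longlongrightarrow> 1 / recip_rate \<mu>1 \<mu>2 N 0 (1 / L2)) at_top"
proof (rule Lim_transform_eventually)
  have "((\<lambda>l. gain \<mu>1 (1 / l) (1 / L2)) \<longlongrightarrow> gain \<mu>1 0 (1 / L2)) at_top"
    by (intro gain_tendsto recip_at_top tendsto_const) simp
  moreover have "\<forall>\<^sub>F l in at_top. gain \<mu>1 (1 / l) (1 / L2) = dca_gain \<mu>1 \<mu>2 (1 / l) (1 / L2)"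
    using eventually_ge_at_top[of L2]
    by eventually_elim (use assms in \<open>auto simp: dca_gain_def field_simps\<close>)
  moreover have "gain \<mu>1 0 (1 / L2) = dca_gain \<mu>1 \<mu>2 0 (1 / L2)"
    using assms by (simp add: dca_gain_def)
  ultimately have "((\<lambda>l. dca_gain \<mu>1 \<mu>2 (1 / l) (1 / L2)) \<longlongrightarrow> dca_gain \<mu>1 \<mu>2 0 (1 / L2)) at_top"
    using Lim_transform_eventually by metis
  then show "((\<lambda>l. 1 / recip_rate \<mu>1 \<mu>2 N (1 / l) (1 / L2)) \<longlongrightarrow> 1 / recip_rate \<mu>1 \<mu>2 N 0 (1 / L2)) at_top"
    using recip_rate_pos[of \<mu>1 \<mu>2 0 "1 / L2" N] assms
    by (intro tendsto_divide tendsto_const recip_rate_tendsto recip_at_top) auto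
  show "\<forall>\<^sub>F l in at_top. 1 / recip_rate \<mu>1 \<mu>2 N (1 / l) (1 / L2) = finite_rate l L2 \<mu>1 \<mu>2 N"
    using eventually_gt_at_top[of "max L2 \<mu>2"]
    by eventually_elim (use assms in \<open>auto simp: finite_rate_eq_distinct\<close>)
qed

lemma finite_rate_tendsto_L2_infinite:
  assumes "0 \<le> \<mu>1" "0 \<le> \<mu>2" "0 < L1" "\<mu>2 < L1" "1 \<le> N"
  shows "((\<lambda>l. finite_rate L1 l \<mu>1 \<mu>2 N) \<longlongrightarrow> 1 / recip_rate \<mu>1 \<mu>2 N (1 / L1) 0) at_top"
proof (rule Lim_transform_eventually)
  have "((\<lambda>l. gain \<mu>2 (1 / l) (1 / L1)) \<longlongrightarrow> gain \<mu>2 0 (1 / L1)) at_top"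
    by (intro gain_tendsto recip_at_top tendsto_const) simp
  moreover have "\<forall>\<^sub>F l in at_top. gain \<mu>2 (1 / l) (1 / L1) = dca_gain \<mu>1 \<mu>2 (1 / L1) (1 / l)"
    using eventually_gt_at_top[of L1]
    by eventually_elim (use assms in \<open>auto simp: dca_gain_def field_simps\<close>)
  moreover have "gain \<mu>2 0 (1 / L1) = dca_gain \<mu>1 \<mu>2 (1 / L1) 0"
    using assms by (simp add: dca_gain_def)
  ultimately have "((\<lambda>l. dca_gain \<mu>1 \<mu>2 (1 / L1) (1 / l)) \<longlongrightarrow> dca_gain \<mu>1 \<mu>2 (1 / L1) 0) at_top"
    using Lim_transform_eventually by metis
  then show "((\<lambda>l. 1 / recip_rate \<mu>1 \<mu>2 N (1 / L1) (1 / l)) \<longlongrightarrow> 1 / recip_rate \<mu>1 \<mu>2 N (1 / L1) 0) at_top"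
    using recip_rate_pos[of \<mu>1 \<mu>2 "1 / L1" 0 N] assms
    by (intro tendsto_divide tendsto_const recip_rate_tendsto recip_at_top) auto
  show "\<forall>\<^sub>F l in at_top. 1 / recip_rate \<mu>1 \<mu>2 N (1 / L1) (1 / l) = finite_rate L1 l \<mu>1 \<mu>2 N"
    using eventually_gt_at_top[of "max L1 \<mu>1"]
    by eventually_elim (use assms in \<open>auto simp: finite_rate_eq_distinct\<close>)
qed

text \<open>As \<open>l\<close> crosses \<open>L\<close>, the roles of the two functions in the rate are exchanged; both branches of
  \<open>dca_gain\<close> have the limit \<open>1 / L\<close>. This includes the removable singularity at \<open>L = \<mu>1 + \<mu>2\<close>.\<close>

lemma finite_rate_tendsto_equal:
  assumes "0 \<le> \<mu>1" "0 \<le> \<mu>2" "0 < L" "\<mu>1 < L" "\<mu>2 < L" "1 \<le> N"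
  shows "((\<lambda>l. finite_rate l L \<mu>1 \<mu>2 N) \<longlongrightarrow> 1 / recip_rate \<mu>1 \<mu>2 N (1 / L) (1 / L)) (at L)"
proof (rule Lim_transform_eventually)
  have recip: "((\<lambda>l. 1 / l) \<longlongrightarrow> 1 / L) (at L)"
    using \<open>0 < L\<close> by (intro tendsto_intros) auto
  have "gain \<mu>2 (1 / L) (1 / L) = gain \<mu>1 (1 / L) (1 / L)"
    using assms by (simp add: gain_def field_simps power2_eq_square)
  then have "((\<lambda>l. gain \<mu>1 (1 / l) (1 / L)) \<longlongrightarrow> gain \<mu>1 (1 / L) (1 / L)) (at L)"
    "((\<lambda>l. gain \<mu>2 (1 / L) (1 / l)) \<longlongrightarrow> gain \<mu>1 (1 / L) (1 / L)) (at L)"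
    using gain_tendsto[OF recip tendsto_const, of \<mu>1 "1 / L"]
      gain_tendsto[OF tendsto_const recip, of \<mu>2 "1 / L"] assms by auto
  then have "((\<lambda>l. dca_gain \<mu>1 \<mu>2 (1 / l) (1 / L)) \<longlongrightarrow> dca_gain \<mu>1 \<mu>2 (1 / L) (1 / L)) (at L)"
    unfolding dca_gain_def by (auto intro!: filterlim_If intro: tendsto_mono[OF inf_le1])
  then show "((\<lambda>l. 1 / recip_rate \<mu>1 \<mu>2 N (1 / l) (1 / L)) \<longlongrightarrow> 1 / recip_rate \<mu>1 \<mu>2 N (1 / L) (1 / L)) (at L)"
    using recip_rate_pos[of \<mu>1 \<mu>2 "1 / L" "1 / L" N] assms
    by (intro tendsto_divide tendsto_const recip_rate_tendsto recip) auto
  have "\<forall>\<^sub>F l in at L. max 0 \<mu>2 < l"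
    using order_tendstoD(1)[OF tendsto_ident_at, of "max 0 \<mu>2" L UNIV] assms by simp
  moreover have "\<forall>\<^sub>F l in at L. l \<noteq> L" by (simp add: eventually_at_filter)
  ultimately show "\<forall>\<^sub>F l in at L. 1 / recip_rate \<mu>1 \<mu>2 N (1 / l) (1 / L) = finite_rate l L \<mu>1 \<mu>2 N"
    by eventually_elim (use assms in \<open>auto simp: finite_rate_eq_distinct\<close>)
qed

lemma rate_quotient_eq:
  assumes "0 \<le> \<mu>1" "0 \<le> \<mu>2" "0 < L1" "0 < L2" "ereal \<mu>2 < L1" "ereal \<mu>1 < L2"
    and fin: "L1 < \<infinity> \<or> L2 < \<infinity>" and "1 \<le> N"
  shows "rate_quotient L1 L2 \<mu>1 \<mu>2 N
    = 1 / recip_rate \<mu>1 \<mu>2 N (smooth_recip L1) (smooth_recip L2)"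
proof -
  consider (inf1) l2 where "L1 = \<infinity>" "L2 = ereal l2" | (inf2) l1 where "L1 = ereal l1" "L2 = \<infinity>"
    | (fin) l1 l2 where "L1 = ereal l1" "L2 = ereal l2"
    using assms by (cases L1; cases L2) auto
  then show ?thesis
  proof cases
    case inf1
    then show ?thesis
      using assms tendsto_Lim[OF _ finite_rate_tendsto_L1_infinite[of \<mu>1 \<mu>2 l2 N]]
      by (simp add: rate_quotient_def)
  next
    case inf2
    then show ?thesis
      using assms tendsto_Lim[OF _ finite_rate_tendsto_L2_infinite[of \<mu>1 \<mu>2 l1 N]]
      by (simp add: rate_quotient_def)
  next
    case fin
    have l: "0 < l1" "0 < l2" "\<mu>1 < l2" "\<mu>2 < l1" using assms fin by auto
    have rate: "0 < recip_rate \<mu>1 \<mu>2 N (1 / l1) (1 / l2)"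
      using l assms by (intro recip_rate_pos) auto
    show ?thesis
    proof (cases "rate_denom l1 l2 \<mu>1 \<mu>2 N = 0")
      case True
      then have A: "rate_A l1 l2 \<mu>1 \<mu>2 = 0"
        using rate rate_denom_eq[of l1 l2 \<mu>1 \<mu>2 N] l assms by simp
      have "l1 = l2"
      proof (rule ccontr)
        assume "l1 \<noteq> l2"
        then show False using finite_rate_eq_distinct[of l1 l2 \<mu>1 \<mu>2 N] A rate l assms
          by (simp add: finite_rate_def)
      qed
      then show ?thesis
        using True fin l assms tendsto_Lim[OF _ finite_rate_tendsto_equal[of \<mu>1 \<mu>2 l1 N]]
        by (simp add: rate_quotient_def)
    next
      case False
      then have "rate_A l1 l2 \<mu>1 \<mu>2 \<noteq> 0"
        using rate_denom_eq[of l1 l2 \<mu>1 \<mu>2 N] l assms by auto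
      then show ?thesis
        using False fin l assms finite_rate_eq[of l1 l2 \<mu>1 \<mu>2 N] by (simp add: rate_quotient_def)
    qed
  qed
qed

section \<open>Convergence rate of the DCA\<close>

text \<open>The objective of the DCA subproblem is \<open>f1\<close> minus an affine function of slope \<open>g\<close>, so minimality at
  \<open>p\<close> is the subgradient inequality for \<open>g\<close> at \<open>p\<close>.\<close>

lemma argmin_subgradient:
  assumes "ereal_proper f1" and "f2x = ereal b"
    and min: "is_arg_min (\<lambda>y. f1 y - f2x - ereal (g \<bullet> (y - x))) (\<lambda>y. True) p"
  shows "g \<in> subdifferential f1 p"
proof -
  have le: "f1 p - ereal (b + g \<bullet> (p - x)) \<le> f1 y - ereal (b + g \<bullet> (y - x))" for y
  proof -
    have "f1 y - f2x - ereal (g \<bullet> (y - x)) = f1 y - ereal (b + g \<bullet> (y - x))" for y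
      by (cases "f1 y") (auto simp: assms(2))
    with min show ?thesis by (auto simp: is_arg_min_def not_less)
  qed
  obtain q where "f1 q < \<infinity>" "f1 q \<noteq> -\<infinity>" "f1 p \<noteq> -\<infinity>" using assms(1) by (auto simp: ereal_proper_def)
  with le[of q] obtain a where a: "f1 p = ereal a" by (cases "f1 p"; cases "f1 q") auto
  show ?thesis
  proof (rule subdifferentialI)
    show "f1 p = ereal a" by fact
    show "ereal (a + g \<bullet> (y - p)) \<le> f1 y" for y
      using le[of y] a by (cases "f1 y") (auto simp: inner_diff_right)
  qed
qed

theorem theorem3p1:
  fixes L1 L2 :: ereal and \<mu>1 \<mu>2 fstar \<Delta> :: real and N :: nat
    and f1 f2 :: "real ^ 'n \<Rightarrow> ereal"
    and x g1 g2 :: "nat \<Rightarrow> real ^ 'n"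
  assumes "0 < L1" and "0 < L2" and "0 \<le> \<mu>1" and "0 \<le> \<mu>2"
    and "ereal \<mu>2 < L1" and "ereal \<mu>1 < L2"
    and "L1 < \<infinity> \<or> L2 < \<infinity>"
    and "f1 \<in> F_class \<mu>1 L1" and "f2 \<in> F_class \<mu>2 L2"
    and "lower_semicont (dc_diff f1 f2)"
    and "\<forall>y. ereal fstar \<le> dc_diff f1 f2 y"
    and "dc_diff f1 f2 (x 1) - ereal fstar = ereal \<Delta>"
    and "1 \<le> N"
    and "dca_run f1 f2 N x g1 g2"
  shows "Min ((\<lambda>k. norm (g1 k - g2 k)) ` {1..N+1})
           \<le> sqrt (rate_quotient L1 L2 \<mu>1 \<mu>2 N * \<Delta>)"
proof -
  define m where "m = Min ((\<lambda>k. norm (g1 k - g2 k)) ` {1..N+1})"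
  define \<iota>1 \<iota>2 where "\<iota>1 = smooth_recip L1" and "\<iota>2 = smooth_recip L2"
  have \<mu>L: "\<mu>1 * \<iota>2 < 1" "\<mu>2 * \<iota>1 < 1" and pos: "0 \<le> \<iota>1" "0 \<le> \<iota>2" "0 < \<iota>1 \<or> 0 < \<iota>2"
    using assms(1-7) by (cases L1; cases L2; simp add: \<iota>1_def \<iota>2_def)+
  have m: "m \<le> norm (g1 k - g2 k)" if "k \<in> {1..N+1}" for k
    unfolding m_def using that by (intro Min_le) auto
  have "m \<in> (\<lambda>k. norm (g1 k - g2 k)) ` {1..N+1}" unfolding m_def by (intro Min_in) auto
  then have "0 \<le> m" by auto
  have proper: "ereal_proper f1" "ereal_proper f2" using assms(8,9) by (auto simp: F_class_def)
  have sub2: "g2 k \<in> subdifferential f2 (x k)" if "k \<in> {1..N+1}" for k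
    using assms(14) that by (simp add: dca_run_def)
  have link: "g1 (Suc k) = g2 k" if "k \<in> {1..N}" for k
    using assms(14) that by (simp add: dca_run_def)
  define a2 where "a2 = (\<lambda>k. real_of_ereal (f2 (x k)))"
  have a2: "f2 (x k) = ereal (a2 k)" if "k \<in> {1..N+1}" for k
    using subdifferential_realE[OF proper(2) sub2[OF that]] by (metis a2_def real_of_ereal.simps(1))
  have sub1': "g2 k \<in> subdifferential f1 (x (Suc k))" if "k \<in> {1..N}" for k
    using argmin_subgradient[OF proper(1) a2, of k "g2 k" "x k" "x (Suc k)"] assms(14) that
    by (simp add: dca_run_def)
  have sub1: "g1 k \<in> subdifferential f1 (x k)" if "k \<in> {1..N+1}" for k
  proof (cases "k = 1")
    case True
    then show ?thesis using assms(14) by (simp add: dca_run_def)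
  next
    case False
    then obtain j where "k = Suc j" "j \<in> {1..N}" using \<open>k \<in> {1..N+1}\<close> by (cases k) auto
    then show ?thesis using sub1' link by simp
  qed
  define a1 where "a1 = (\<lambda>k. real_of_ereal (f1 (x k)))"
  have a1: "f1 (x k) = ereal (a1 k)" if "k \<in> {1..N+1}" for k
    using subdifferential_realE[OF proper(1) sub1[OF that]] by (metis a1_def real_of_ereal.simps(1))
  have step: "dca_gain \<mu>1 \<mu>2 \<iota>1 \<iota>2 * m\<^sup>2 \<le> (a1 k - a2 k) - (a1 (Suc k) - a2 (Suc k))"
    if k: "k \<in> {1..N}" for k
    unfolding \<iota>1_def \<iota>2_def
  proof (rule dca_step_decrease[OF assms(8,9,1,2,7,3,4)])
    have mem: "k \<in> {1..N+1}" "Suc k \<in> {1..N+1}" using k by auto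
    show "g1 k \<in> subdifferential f1 (x k)" "g2 k \<in> subdifferential f2 (x k)"
      "g2 (Suc k) \<in> subdifferential f2 (x (Suc k))" "f1 (x k) = ereal (a1 k)"
      "f2 (x k) = ereal (a2 k)" "f1 (x (Suc k)) = ereal (a1 (Suc k))"
      "f2 (x (Suc k)) = ereal (a2 (Suc k))" "m \<le> norm (g1 k - g2 k)"
      using mem sub1 sub2 a1 a2 m by blast+
    show "m \<le> norm (g2 k - g2 (Suc k))" using m[OF mem(2)] link[OF k] by simp
    show "g2 k \<in> subdifferential f1 (x (Suc k))" using sub1' k by blast
  qed (use \<mu>L \<open>0 \<le> m\<close> in \<open>auto simp: \<iota>1_def \<iota>2_def\<close>)
  have "(\<Sum>k\<in>{1..N}. dca_gain \<mu>1 \<mu>2 \<iota>1 \<iota>2 * m\<^sup>2)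
      \<le> (\<Sum>k\<in>{1..N}. (a1 k - a2 k) - (a1 (Suc k) - a2 (Suc k)))"
    by (intro sum_mono step)
  also have "\<dots> = (a1 1 - a2 1) - (a1 (N + 1) - a2 (N + 1))"
    using sum_Suc_diff[of 1 N "\<lambda>k. - (a1 k - a2 k)"] assms(13) by (simp add: algebra_simps)
  finally have decrease: "real N * dca_gain \<mu>1 \<mu>2 \<iota>1 \<iota>2 * m\<^sup>2
      \<le> (a1 1 - a2 1) - (a1 (N + 1) - a2 (N + 1))" by simp
  have "\<iota>1 / (2 * (1 - \<mu>2 * \<iota>1)) * (norm (g1 (N + 1) - g2 (N + 1)))\<^sup>2
      \<le> a1 (N + 1) - a2 (N + 1) - fstar"
    unfolding \<iota>1_def using assms(11) \<mu>L(2) sub1 sub2 a1 a2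
    by (intro criticality_gap_bound[OF assms(8,9,1)]) (auto simp: \<iota>1_def)
  moreover have "\<iota>1 / (2 * (1 - \<mu>2 * \<iota>1)) * m\<^sup>2
      \<le> \<iota>1 / (2 * (1 - \<mu>2 * \<iota>1)) * (norm (g1 (N + 1) - g2 (N + 1)))\<^sup>2"
    using pos \<mu>L m[of "N + 1"] \<open>0 \<le> m\<close> by (intro mult_left_mono power_mono) auto
  moreover have "\<Delta> = a1 1 - a2 1 - fstar"
    using assms(12) a1[of 1] a2[of 1] by (simp add: dc_diff_def)
  ultimately have "recip_rate \<mu>1 \<mu>2 N \<iota>1 \<iota>2 * m\<^sup>2 \<le> \<Delta>"
    using decrease unfolding recip_rate_def by (simp only: distrib_right)
  moreover have "0 < recip_rate \<mu>1 \<mu>2 N \<iota>1 \<iota>2"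
    using assms(3,4,13) pos \<mu>L by (intro recip_rate_pos) auto
  ultimately have "m\<^sup>2 \<le> 1 / recip_rate \<mu>1 \<mu>2 N \<iota>1 \<iota>2 * \<Delta>"
    by (simp add: pos_le_divide_eq mult_ac)
  also have "1 / recip_rate \<mu>1 \<mu>2 N \<iota>1 \<iota>2 = rate_quotient L1 L2 \<mu>1 \<mu>2 N"
    unfolding \<iota>1_def \<iota>2_def using assms(1-7,13) by (intro rate_quotient_eq[symmetric]) auto
  finally show ?thesis unfolding m_def by (rule real_le_rsqrt)
qed

end
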